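(* Consider an episodic deterministic system (deterministic transitions and deterministic rewards) with an arbitrary action space $\mathcal{A}$, and a function class $\mathcal{F}$ of functions $\mathcal{S}\times\mathcal{A}\to\mathbb{R}$. Let $\rho$ be the optimality gap of the system and $\delta$ the approximation error of $\mathcal{F}$. Suppose $$\rho\;\ge\;6\sqrt{2}\,\delta\sqrt{\dim_E(\mathcal{F},\rho/4)} ,$$ where $\dim_E$ is the Eluder dimension. Then the Main Algorithm described in the context (the recursive procedure Explore started at $s_1$, using the Maximum Uncertainty Oracle) returns the optimal policy $\pi^*$ using at most $O(\dim_E(\mathcal{F},\rho/4))$ trajectories.
   Context: Episodic deterministic system: a tuple $(\mathcal{S},\mathcal{A},H,P,r)$ with horizon $H\in\mathbb{Z}_+$, state space $\mathcal{S}$ that is the disjoint union of the level sets $\mathcal{S}_1,\dots,\mathcal{S}_H$, deterministic transition function $P:\mathcal{S}\times\mathcal{A}\to\mathcal{S}$ (taking level $h$ to level $h+1$), deterministic reward function $r:\mathcal{S}\times\mathcal{A}\to\mathbb{R}$, and a fixed initial state $s_1$. A trajectory is $s_1,a_1,r_1,\dots,s_H,a_H,r_H$ with $r_h=r(s_h,a_h)$, $s_{h+1}=P(s_h,a_h)$; it is assumed that $\sum_{h=1}^H r_h\in[0,1]$. A policy maps each state to a distribution over actions; $\pi^*$ is a policy maximizing the expected total reward. $V^*(s)$ is the optimal total reward from state $s$ until the end of the episode, and $Q^*(s,a)$ is the total reward when action $a$ is taken in $s$ and $\pi^*$ is followed afterwards. $P$ and $r$ are unknown; their values are observed by sampling trajectories.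 Optimality gap: $\rho=\inf_{(s,a):\,Q^*(s,a)\ne V^*(s)}\big(V^*(s)-Q^*(s,a)\big)$. Approximation error: $\delta=\inf_{f\in\mathcal{F}}\sup_{(s,a)\in\mathcal{S}\times\mathcal{A}}|f(s,a)-Q^*(s,a)|$. $\epsilon$-dependence: $(s,a)$ is $\epsilon$-dependent on $\{(s_1,a_1),\dots,(s_n,a_n)\}$ with respect to $\mathcal{F}$ if for all $f_1,f_2\in\mathcal{F}$, $\sum_{i=1}^n|f_1(s_i,a_i)-f_2(s_i,a_i)|^2\le\epsilon^2$ implies $|f_1(s,a)-f_2(s,a)|^2\le\epsilon^2$; otherwise it is $\epsilon$-independent of them. Eluder dimension: $\dim_E(\mathcal{F},\epsilon)$ is the length of the longest sequence of elements of $\mathcal{S}\times\mathcal{A}$ such that every element is $\epsilon'$-independent of its predecessors for some $\epsilon'\ge\epsilon$. Maximum Uncertainty Oracle: for a state $s$, a number $\eta\ge0$ and a finite data set $Y$ of triples $(s',a',y')$, Oracle$(s,\eta,Y)$ finds $$(\hat a,\hat f_1,\hat f_2)=\arg\max_{a\in\mathcal{A},\,f_1,f_2\in\mathcal{F}}|f_1(s,a)-f_2(s,a)|^2\quad\text{s.t.}\quad\frac1{|Y|}\sum_{(s',a',y')\in Y}|f_1(s',a')-f_2(s',a')|^2\le\eta^2$$ (no constraint if $Y$ is empty) and returns the pair $(\hat a,\,|\hat f_1(s,\hat a)-\hat f_2(s,\hat a)|)$. Main Algorithm: initialize the policy $\pi$ and the function $f$ arbitrarily; set the global data set $Y=\{\}$;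 invoke Explore$(s_1)$; return $\pi$. Explore$(s)$: (1) Set $(a,u)=$ Oracle$(s,2\delta,Y)$. (2) While $u>|\rho/2-\delta|$: add to $Y$ the triple $(s,a,r(s,a))$ if $s\in\mathcal{S}_H$, and the triple $(s,a,\text{Explore}(P(s,a))+r(s,a))$ otherwise; then set $(a,u)=$ Oracle$(s,2\delta,Y)$ again. (3) Set $f=\arg\min_{f\in\mathcal{F}}\sum_{(s_i,a_i,y_i)\in Y}|f(s_i,a_i)-y_i|^2$. (4) Set $\pi(s)=\arg\max_{a\in\mathcal{A}}f(s,a)$. (5) Return $r(s,\pi(s))$ if $s\in\mathcal{S}_H$, and $r(s,\pi(s))+\text{Explore}(P(s,\pi(s)))$ otherwise.
   Formalization: The bound is 4·H·dim_E (a constant independent of H is impossible); dim_E is finite and at least 1; the infimum δ is attained; and if the oracle value equals |ρ/2−δ| exactly, the argmax set of f(s,·) is assumed not to mix optimal and suboptimal actions. *)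

theory Defs
  imports "HOL-Probability.Probability_Mass_Function" "HOL-Library.Extended_Real"
begin

section \<open>Episodic deterministic systems\<close>

text \<open>The state space and the action space are the (arbitrary) types \<open>'s\<close> and \<open>'a\<close>;
  \<open>stage M h\<close> is the level set of index \<open>h\<close>.\<close>

record ('s, 'a) system =
  horizon :: nat
  stage :: "nat \<Rightarrow> 's set"
  trans :: "'s \<Rightarrow> 'a \<Rightarrow> 's"
  reward :: "'s \<Rightarrow> 'a \<Rightarrow> real"
  start :: 's

primrec total_reward :: "('s, 'a) system \<Rightarrow> 's \<Rightarrow> 'a list \<Rightarrow> real" where
  "total_reward M s [] = 0"
| "total_reward M s (a # as) = reward M s a + total_reward M (trans M s a) as"

definition episodic_system :: "('s, 'a) system \<Rightarrow> bool" where
  "episodic_system M \<longleftrightarrow>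
     1 \<le> horizon M \<and>
     disjoint_family_on (stage M) {1..horizon M} \<and>
     (\<Union>h\<in>{1..horizon M}. stage M h) = UNIV \<and>
     (\<forall>h\<in>{1..<horizon M}. \<forall>s\<in>stage M h. \<forall>a. trans M s a \<in> stage M (h + 1)) \<and>
     start M \<in> stage M 1 \<and>
     (\<forall>as. length as = horizon M \<longrightarrow> total_reward M (start M) as \<in> {0..1})"

definition level :: "('s, 'a) system \<Rightarrow> 's \<Rightarrow> nat" where
  "level M s = (THE h. h \<in> {1..horizon M} \<and> s \<in> stage M h)"

definition steps_left :: "('s, 'a) system \<Rightarrow> 's \<Rightarrow> nat" where
  "steps_left M s = horizon M + 1 - level M s"


section \<open>Policies, optimality and value functions\<close>

text \<open>\<open>exp_reward M p n s\<close> is the expected reward collected in \<open>n\<close> steps from \<open>s\<close> under \<open>p\<close>. The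
  integral of a non-integrable function is \<open>0\<close> in the library, and rewards from states that cannot
  be reached from \<open>start M\<close> need not be bounded; \<open>exp_reward_exists\<close> says that all the
  expectations involved are genuine.\<close>

primrec exp_reward :: "('s, 'a) system \<Rightarrow> ('s \<Rightarrow> 'a pmf) \<Rightarrow> nat \<Rightarrow> 's \<Rightarrow> real" where
  "exp_reward M p 0 s = 0"
| "exp_reward M p (Suc n) s =
     measure_pmf.expectation (p s) (\<lambda>a. reward M s a + exp_reward M p n (trans M s a))"

primrec exp_reward_exists :: "('s, 'a) system \<Rightarrow> ('s \<Rightarrow> 'a pmf) \<Rightarrow> nat \<Rightarrow> 's \<Rightarrow> bool" where
  "exp_reward_exists M p 0 s \<longleftrightarrow> True"
| "exp_reward_exists M p (Suc n) s \<longleftrightarrow>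
     integrable (measure_pmf (p s)) (\<lambda>a. reward M s a + exp_reward M p n (trans M s a)) \<and>
     (\<forall>a\<in>set_pmf (p s). exp_reward_exists M p n (trans M s a))"

definition policy_value :: "('s, 'a) system \<Rightarrow> ('s \<Rightarrow> 'a pmf) \<Rightarrow> 's \<Rightarrow> real" where
  "policy_value M p s = exp_reward M p (steps_left M s) s"

definition policy_value_exists :: "('s, 'a) system \<Rightarrow> ('s \<Rightarrow> 'a pmf) \<Rightarrow> 's \<Rightarrow> bool" where
  "policy_value_exists M p s \<longleftrightarrow> exp_reward_exists M p (steps_left M s) s"

definition optimal_from :: "('s, 'a) system \<Rightarrow> 's \<Rightarrow> ('s \<Rightarrow> 'a pmf) \<Rightarrow> bool" where
  "optimal_from M s p \<longleftrightarrow>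
     policy_value_exists M p s \<and>
     (\<forall>q. policy_value_exists M q s \<longrightarrow> policy_value M q s \<le> policy_value M p s)"

text \<open>Below, \<open>ps\<close> is a policy that is optimal from every state.\<close>

definition Vstar :: "('s, 'a) system \<Rightarrow> ('s \<Rightarrow> 'a pmf) \<Rightarrow> 's \<Rightarrow> real" where
  "Vstar M ps s = policy_value M ps s"

definition Qstar :: "('s, 'a) system \<Rightarrow> ('s \<Rightarrow> 'a pmf) \<Rightarrow> 's \<Rightarrow> 'a \<Rightarrow> real" where
  "Qstar M ps s a =
     reward M s a + (if s \<in> stage M (horizon M) then 0 else policy_value M ps (trans M s a))"

definition optimality_gap :: "('s, 'a) system \<Rightarrow> ('s \<Rightarrow> 'a pmf) \<Rightarrow> ereal" where
  "optimality_gap M ps =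
     (INF (s, a) \<in> {(s, a). Qstar M ps s a \<noteq> Vstar M ps s}.
        ereal (Vstar M ps s - Qstar M ps s a))"

definition approximation_error ::
    "('s, 'a) system \<Rightarrow> ('s \<Rightarrow> 'a pmf) \<Rightarrow> ('s \<Rightarrow> 'a \<Rightarrow> real) set \<Rightarrow> ereal" where
  "approximation_error M ps F =
     (INF f \<in> F. SUP (s, a) \<in> UNIV. ereal \<bar>f s a - Qstar M ps s a\<bar>)"


section \<open>Eluder dimension\<close>

definition eluder_dependent ::
    "('s \<Rightarrow> 'a \<Rightarrow> real) set \<Rightarrow> real \<Rightarrow> 's \<times> 'a \<Rightarrow> ('s \<times> 'a) list \<Rightarrow> bool" where
  "eluder_dependent F \<epsilon> x xs \<longleftrightarrow>
     (\<forall>f1\<in>F. \<forall>f2\<in>F.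
        (\<Sum>(s, a)\<leftarrow>xs. \<bar>f1 s a - f2 s a\<bar>\<^sup>2) \<le> \<epsilon>\<^sup>2 \<longrightarrow>
        \<bar>f1 (fst x) (snd x) - f2 (fst x) (snd x)\<bar>\<^sup>2 \<le> \<epsilon>\<^sup>2)"

text \<open>One \<open>\<epsilon>' \<ge> \<epsilon>\<close> serves for the whole sequence.\<close>

definition eluder_dimension :: "('s \<Rightarrow> 'a \<Rightarrow> real) set \<Rightarrow> real \<Rightarrow> enat" where
  "eluder_dimension F \<epsilon> =
     (SUP xs \<in> {xs. \<exists>\<epsilon>'\<ge>\<epsilon>. \<forall>i<length xs. \<not> eluder_dependent F \<epsilon>' (xs ! i) (take i xs)}.
        enat (length xs))"


section \<open>Maximum uncertainty oracle, regression and greedy action\<close>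

text \<open>A data set is a multiset: a triple that is added twice counts twice, both in \<open>size\<close>
  and in the sums.\<close>

type_synonym ('s, 'a) dataset = "('s \<times> 'a \<times> real) multiset"

definition admissible_pair ::
    "('s \<Rightarrow> 'a \<Rightarrow> real) set \<Rightarrow> real \<Rightarrow> ('s, 'a) dataset \<Rightarrow>
     ('s \<Rightarrow> 'a \<Rightarrow> real) \<Rightarrow> ('s \<Rightarrow> 'a \<Rightarrow> real) \<Rightarrow> bool" where
  "admissible_pair F \<eta> Y f1 f2 \<longleftrightarrow>
     f1 \<in> F \<and> f2 \<in> F \<and>
     (Y = {#} \<or>
      (1 / real (size Y)) * (\<Sum>(s', a', y')\<in>#Y. \<bar>f1 s' a' - f2 s' a'\<bar>\<^sup>2) \<le> \<eta>\<^sup>2)"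

definition max_uncertainty_oracle ::
    "('s \<Rightarrow> 'a \<Rightarrow> real) set \<Rightarrow> ('s \<Rightarrow> real \<Rightarrow> ('s, 'a) dataset \<Rightarrow> 'a \<times> real) \<Rightarrow> bool" where
  "max_uncertainty_oracle F oracl \<longleftrightarrow>
     (\<forall>s \<eta> Y. 0 \<le> \<eta> \<longrightarrow>
        (\<exists>a f1 f2.
           admissible_pair F \<eta> Y f1 f2 \<and>
           (\<forall>b g1 g2. admissible_pair F \<eta> Y g1 g2 \<longrightarrow>
              \<bar>g1 s b - g2 s b\<bar>\<^sup>2 \<le> \<bar>f1 s a - f2 s a\<bar>\<^sup>2) \<and>
           oracl s \<eta> Y = (a, \<bar>f1 s a - f2 s a\<bar>)))"

definition squared_loss :: "('s, 'a) dataset \<Rightarrow> ('s \<Rightarrow> 'a \<Rightarrow> real) \<Rightarrow> real" where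
  "squared_loss Y f = (\<Sum>(s, a, y)\<in>#Y. \<bar>f s a - y\<bar>\<^sup>2)"

definition least_squares ::
    "('s \<Rightarrow> 'a \<Rightarrow> real) set \<Rightarrow> (('s, 'a) dataset \<Rightarrow> 's \<Rightarrow> 'a \<Rightarrow> real) \<Rightarrow> bool" where
  "least_squares F fit \<longleftrightarrow>
     (\<forall>Y. fit Y \<in> F \<and> (\<forall>g\<in>F. squared_loss Y (fit Y) \<le> squared_loss Y g))"

definition maximizes :: "('s \<Rightarrow> 'a \<Rightarrow> real) \<Rightarrow> 's \<Rightarrow> 'a \<Rightarrow> bool" where
  "maximizes f s a \<longleftrightarrow> (\<forall>b. f s b \<le> f s a)"

definition greedy_selector ::
    "('s \<Rightarrow> 'a \<Rightarrow> real) set \<Rightarrow> (('s \<Rightarrow> 'a \<Rightarrow> real) \<Rightarrow> 's \<Rightarrow> 'a) \<Rightarrow> bool" where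
  "greedy_selector F greedy \<longleftrightarrow> (\<forall>f\<in>F. \<forall>s. maximizes f s (greedy f s))"


section \<open>The algorithm\<close>

text \<open>The global variables, together with the number of trajectories sampled so far. A trajectory
  ends exactly when an action is taken in the last level, in step (2) or in step (5), and that is
  where \<open>trajectories\<close> is incremented. To take another action in an earlier state the agent begins
  a new episode and repeats the known actions that lead to that state.\<close>

record ('s, 'a) memory =
  dataset :: "('s, 'a) dataset"
  estimate :: "'s \<Rightarrow> 'a \<Rightarrow> real"
  policy :: "'s \<Rightarrow> 'a"
  trajectories :: nat

definition record_sample :: "'s \<Rightarrow> 'a \<Rightarrow> real \<Rightarrow> ('s, 'a) memory \<Rightarrow> ('s, 'a) memory" where
  "record_sample s a y m = m\<lparr>dataset := add_mset (s, a, y) (dataset m)\<rparr>"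

definition end_trajectory :: "('s, 'a) memory \<Rightarrow> ('s, 'a) memory" where
  "end_trajectory m = m\<lparr>trajectories := trajectories m + 1\<rparr>"

definition fit_and_act ::
    "(('s, 'a) dataset \<Rightarrow> 's \<Rightarrow> 'a \<Rightarrow> real) \<Rightarrow> (('s \<Rightarrow> 'a \<Rightarrow> real) \<Rightarrow> 's \<Rightarrow> 'a) \<Rightarrow>
     's \<Rightarrow> ('s, 'a) memory \<Rightarrow> ('s, 'a) memory" where
  "fit_and_act fit greedy s m =
     m\<lparr>estimate := fit (dataset m), policy := (policy m)(s := greedy (fit (dataset m)) s)\<rparr>"

text \<open>Big-step semantics: \<open>explore \<dots> s m m' v\<close> means that the call Explore(\<open>s\<close>) in memory \<open>m\<close>
  terminates with memory \<open>m'\<close> and return value \<open>v\<close>, and \<open>explore_loop \<dots> s m m'\<close> that steps (1) and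
  (2) of such a call turn \<open>m\<close> into \<open>m'\<close>.\<close>

inductive
  explore :: "('s, 'a) system \<Rightarrow> ('s \<Rightarrow> real \<Rightarrow> ('s, 'a) dataset \<Rightarrow> 'a \<times> real) \<Rightarrow>
    (('s, 'a) dataset \<Rightarrow> 's \<Rightarrow> 'a \<Rightarrow> real) \<Rightarrow> (('s \<Rightarrow> 'a \<Rightarrow> real) \<Rightarrow> 's \<Rightarrow> 'a) \<Rightarrow> real \<Rightarrow> real \<Rightarrow>
    's \<Rightarrow> ('s, 'a) memory \<Rightarrow> ('s, 'a) memory \<Rightarrow> real \<Rightarrow> bool"
and
  explore_loop :: "('s, 'a) system \<Rightarrow> ('s \<Rightarrow> real \<Rightarrow> ('s, 'a) dataset \<Rightarrow> 'a \<times> real) \<Rightarrow>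
    (('s, 'a) dataset \<Rightarrow> 's \<Rightarrow> 'a \<Rightarrow> real) \<Rightarrow> (('s \<Rightarrow> 'a \<Rightarrow> real) \<Rightarrow> 's \<Rightarrow> 'a) \<Rightarrow> real \<Rightarrow> real \<Rightarrow>
    's \<Rightarrow> ('s, 'a) memory \<Rightarrow> ('s, 'a) memory \<Rightarrow> bool"
for M oracl fit greedy \<rho> \<delta>
where
  loop_exit:
    "\<lbrakk>oracl s (2 * \<delta>) (dataset m) = (a, u); \<not> u > \<bar>\<rho> / 2 - \<delta>\<bar>\<rbrakk>
     \<Longrightarrow> explore_loop M oracl fit greedy \<rho> \<delta> s m m"
| loop_last:
    "\<lbrakk>oracl s (2 * \<delta>) (dataset m) = (a, u); u > \<bar>\<rho> / 2 - \<delta>\<bar>;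
      s \<in> stage M (horizon M);
      explore_loop M oracl fit greedy \<rho> \<delta> s
        (record_sample s a (reward M s a) (end_trajectory m)) m'\<rbrakk>
     \<Longrightarrow> explore_loop M oracl fit greedy \<rho> \<delta> s m m'"
| loop_rec:
    "\<lbrakk>oracl s (2 * \<delta>) (dataset m) = (a, u); u > \<bar>\<rho> / 2 - \<delta>\<bar>;
      s \<notin> stage M (horizon M);
      explore M oracl fit greedy \<rho> \<delta> (trans M s a) m m1 v;
      explore_loop M oracl fit greedy \<rho> \<delta> s (record_sample s a (v + reward M s a) m1) m'\<rbrakk>
     \<Longrightarrow> explore_loop M oracl fit greedy \<rho> \<delta> s m m'"
| explore_last:
    "\<lbrakk>explore_loop M oracl fit greedy \<rho> \<delta> s m m1;
      m2 = fit_and_act fit greedy s m1;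
      s \<in> stage M (horizon M)\<rbrakk>
     \<Longrightarrow> explore M oracl fit greedy \<rho> \<delta> s m (end_trajectory m2) (reward M s (policy m2 s))"
| explore_rec:
    "\<lbrakk>explore_loop M oracl fit greedy \<rho> \<delta> s m m1;
      m2 = fit_and_act fit greedy s m1;
      s \<notin> stage M (horizon M);
      explore M oracl fit greedy \<rho> \<delta> (trans M s (policy m2 s)) m2 m3 v\<rbrakk>
     \<Longrightarrow> explore M oracl fit greedy \<rho> \<delta> s m m3 (reward M s (policy m2 s) + v)"

text \<open>\<open>f0\<close> and \<open>p0\<close> are the arbitrary initial function and policy; the algorithm returns
  \<open>policy m\<close>.\<close>

definition main_algorithm ::
    "('s, 'a) system \<Rightarrow> ('s \<Rightarrow> real \<Rightarrow> ('s, 'a) dataset \<Rightarrow> 'a \<times> real) \<Rightarrow>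
     (('s, 'a) dataset \<Rightarrow> 's \<Rightarrow> 'a \<Rightarrow> real) \<Rightarrow> (('s \<Rightarrow> 'a \<Rightarrow> real) \<Rightarrow> 's \<Rightarrow> 'a) \<Rightarrow> real \<Rightarrow> real \<Rightarrow>
     ('s \<Rightarrow> 'a \<Rightarrow> real) \<Rightarrow> ('s \<Rightarrow> 'a) \<Rightarrow> ('s, 'a) memory \<Rightarrow> bool" where
  "main_algorithm M oracl fit greedy \<rho> \<delta> f0 p0 m \<longleftrightarrow>
     (\<exists>v. explore M oracl fit greedy \<rho> \<delta> (start M)
        \<lparr>dataset = {#}, estimate = f0, policy = p0, trajectories = 0\<rparr> m v)"

end

theory Submission
  imports Defs
begin

text \<open>Correctness: as long as every recorded value equals \<open>Qstar\<close>, the least squares fit \<open>f\<close> and a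
  best approximation of \<open>Qstar\<close> in \<open>F\<close> form an admissible pair for the oracle with
  \<open>\<eta> = 2 * \<delta>\<close>. When the loop stops they therefore differ by at most \<open>\<rho> / 2 - \<delta>\<close> on the current
  state, so \<open>f\<close> is \<open>\<rho> / 2\<close>-close to \<open>Qstar\<close> there and the greedy action loses at most \<open>\<rho>\<close>; a
  suboptimal one loses at least \<open>\<rho>\<close>, and the case of equality is a tie.

  Sample complexity: the chosen actions, recorded or still pending, are distributed over
  \<open>2 * horizon M\<close> sequences in which every element is independent of its predecessors, hence of
  length at most \<open>d\<close>. If a new action were dependent on all of these sequences, the pair found by
  the oracle would be far apart on each of them. At most \<open>horizon M - 1\<close> of them contain a pending
  action, and the others make the squared distance on the data set exceed the admissible amount.
  Every trajectory except one pays for one recorded sample.\<close>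

section \<open>Levels of states, policy values and Bellman equations\<close>

lemma level_eqI:
  assumes "episodic_system M" "h \<in> {1..horizon M}" "s \<in> stage M h"
  shows "level M s = h"
  using assms unfolding level_def episodic_system_def disjoint_family_on_def
  by (intro the_equality) blast+

lemma level_bounds:
  assumes "episodic_system M"
  shows "1 \<le> level M s" "level M s \<le> horizon M" "s \<in> stage M (level M s)"
proof -
  have "s \<in> (\<Union>h\<in>{1..horizon M}. stage M h)"
    using assms by (simp add: episodic_system_def)
  then obtain h where h: "h \<in> {1..horizon M}" "s \<in> stage M h" by blast
  with level_eqI[OF assms] have "level M s = h" by blast
  with h show "1 \<le> level M s" "level M s \<le> horizon M" "s \<in> stage M (level M s)" by auto
qed

lemma last_stage_iff:
  assumes "episodic_system M"
  shows "s \<in> stage M (horizon M) \<longleftrightarrow> level M s = horizon M"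
  using level_eqI[OF assms] level_bounds[OF assms] assms
  by (metis atLeastAtMost_iff episodic_system_def order_refl)

lemma level_trans:
  assumes "episodic_system M" "level M s < horizon M"
  shows "level M (trans M s a) = Suc (level M s)"
proof (rule level_eqI[OF assms(1)])
  show "Suc (level M s) \<in> {1..horizon M}" using assms by auto
  have "\<forall>h\<in>{1..<horizon M}. \<forall>s\<in>stage M h. \<forall>a. trans M s a \<in> stage M (h + 1)"
    using assms by (simp add: episodic_system_def)
  then show "trans M s a \<in> stage M (Suc (level M s))"
    using assms level_bounds[OF assms(1), of s] by auto
qed

lemma level_less_horizon:
  assumes "episodic_system M" "s \<notin> stage M (horizon M)"
  shows "level M s < horizon M"
  using assms last_stage_iff level_bounds(2) by (metis le_neq_implies_less)

text \<open>Levels strictly increase along a trajectory, so states below level \<open>l\<close> are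
  never visited. The bound on \<open>n\<close> keeps the recursion inside the episode: from the last
  level \<open>trans\<close> may lead anywhere.\<close>

lemma exp_reward_agree:
  assumes M: "episodic_system M" and agree: "\<And>t. l \<le> level M t \<Longrightarrow> p t = q t"
  shows "l \<le> level M s \<Longrightarrow> n \<le> steps_left M s \<Longrightarrow>
    exp_reward M p n s = exp_reward M q n s \<and>
    exp_reward_exists M p n s = exp_reward_exists M q n s"
proof (induction n arbitrary: s)
  case (Suc n)
  have "exp_reward M p n (trans M s a) = exp_reward M q n (trans M s a) \<and>
    exp_reward_exists M p n (trans M s a) = exp_reward_exists M q n (trans M s a)" for a
  proof (cases "n = 0")
    case False
    then have "level M s < horizon M"
      using Suc.prems by (simp add: steps_left_def)
    from level_trans[OF M this] show ?thesis
      using Suc.prems by (intro Suc.IH) (auto simp: steps_left_def)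
  qed simp
  with Suc.prems show ?case by (simp add: agree)
qed simp

lemma steps_left_last:
  assumes "episodic_system M" "s \<in> stage M (horizon M)"
  shows "steps_left M s = Suc 0"
  using last_stage_iff[OF assms(1)] assms(2) by (simp add: steps_left_def)

lemma steps_left_trans:
  assumes "episodic_system M" "s \<notin> stage M (horizon M)"
  obtains n where "steps_left M s = Suc n" "\<And>a. steps_left M (trans M s a) = n"
proof -
  have "level M s < horizon M" using level_less_horizon[OF assms] .
  with level_trans[OF assms(1)] show ?thesis
    by (intro that[of "horizon M - level M s"]) (auto simp: steps_left_def)
qed

lemma policy_value_Bellman:
  assumes "episodic_system M"
  shows "policy_value M p s = measure_pmf.expectation (p s) (Qstar M p s)"
proof (cases "s \<in> stage M (horizon M)")
  case True
  then show ?thesis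
    using assms by (simp add: policy_value_def steps_left_last Qstar_def [abs_def])
next
  case False
  obtain n where "steps_left M s = Suc n" "\<And>a. steps_left M (trans M s a) = n"
    using steps_left_trans[OF assms False] by blast
  with False show ?thesis by (simp add: policy_value_def Qstar_def [abs_def])
qed

lemma policy_value_exists_iff:
  assumes "episodic_system M"
  shows "policy_value_exists M p s \<longleftrightarrow>
    integrable (measure_pmf (p s)) (Qstar M p s) \<and>
    (s \<notin> stage M (horizon M) \<longrightarrow> (\<forall>a\<in>set_pmf (p s). policy_value_exists M p (trans M s a)))"
proof (cases "s \<in> stage M (horizon M)")
  case True
  then show ?thesis
    using assms by (simp add: policy_value_exists_def steps_left_last Qstar_def [abs_def])
next
  case False
  obtain n where "steps_left M s = Suc n" "\<And>a. steps_left M (trans M s a) = n"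
    using steps_left_trans[OF assms False] by blast
  with False show ?thesis
    by (simp add: policy_value_exists_def policy_value_def Qstar_def [abs_def])
qed

lemma policy_value_agree:
  assumes "episodic_system M" "\<And>t. level M s \<le> level M t \<Longrightarrow> p t = q t"
  shows "policy_value M p s = policy_value M q s"
    and "policy_value_exists M p s = policy_value_exists M q s"
  using exp_reward_agree[of M "level M s" p q s "steps_left M s"] assms
  by (simp_all add: policy_value_def policy_value_exists_def)

lemma Qstar_agree:
  assumes M: "episodic_system M" and agree: "\<And>t. level M s < level M t \<Longrightarrow> p t = q t"
  shows "Qstar M p s a = Qstar M q s a"
proof (cases "s \<in> stage M (horizon M)")
  case False
  then have "policy_value M p (trans M s a) = policy_value M q (trans M s a)"
    using level_trans[OF M level_less_horizon[OF M False]]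
    by (intro policy_value_agree(1)[OF M] agree) auto
  then show ?thesis by (simp add: Qstar_def)
qed (simp add: Qstar_def)

lemma policy_value_return_pmf:
  assumes "episodic_system M"
  shows "policy_value M (\<lambda>s. return_pmf (\<pi> s)) s = Qstar M (\<lambda>s. return_pmf (\<pi> s)) s (\<pi> s)"
  using policy_value_Bellman[OF assms, of "\<lambda>s. return_pmf (\<pi> s)" s]
  by simp

lemma policy_value_exists_return_pmf: "policy_value_exists M (\<lambda>s. return_pmf (\<pi> s)) s"
proof -
  have "exp_reward_exists M (\<lambda>s. return_pmf (\<pi> s)) n s" for n
    by (induction n arbitrary: s) (simp_all add: integrable_measure_pmf_finite)
  then show ?thesis by (simp add: policy_value_exists_def)
qed

text \<open>One-step deviation: \<open>q\<close> plays \<open>a\<close> in \<open>s\<close> and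
  follows \<open>ps\<close> elsewhere. Since \<open>s\<close> is not visited again, the value of
  \<open>q\<close> at \<open>s\<close> is \<open>Qstar M ps s a\<close>; it exists because its first
  expectation is over a point mass.\<close>

lemma Qstar_le_Vstar:
  assumes M: "episodic_system M" and opt: "\<And>s. optimal_from M s ps"
  shows "Qstar M ps s a \<le> Vstar M ps s"
proof -
  define q where "q = ps(s := return_pmf a)"
  have agree: "q t = ps t" if "level M s < level M t" for t
    using that by (auto simp: q_def)
  have Q: "Qstar M q s = Qstar M ps s"
    by (intro ext Qstar_agree[OF M] agree)
  have "policy_value_exists M q (trans M s a)" if "s \<notin> stage M (horizon M)"
  proof -
    have "policy_value_exists M q (trans M s a) = policy_value_exists M ps (trans M s a)"
      using level_trans[OF M level_less_horizon[OF M that]]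
      by (intro policy_value_agree(2)[OF M] agree) auto
    then show ?thesis using opt by (simp add: optimal_from_def)
  qed
  then have "policy_value_exists M q s"
    by (subst policy_value_exists_iff[OF M])
      (simp add: q_def integrable_measure_pmf_finite)
  then have "policy_value M q s \<le> policy_value M ps s"
    using opt by (simp add: optimal_from_def)
  moreover have "policy_value M q s = Qstar M ps s a"
    by (subst policy_value_Bellman[OF M]) (simp add: Q, simp add: q_def)
  ultimately show ?thesis by (simp add: Vstar_def)
qed

text \<open>The action space may be infinite, so no maximum is formed. \<open>Vstar\<close> is the
  mean of \<open>Qstar\<close> over \<open>ps s\<close> and also bounds it from above; hence the two
  agree on the support, which is nonempty.\<close>

lemma optimal_action_exists:
  assumes M: "episodic_system M" and opt: "\<And>s. optimal_from M s ps"
  obtains a where "Qstar M ps s a = Vstar M ps s"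
proof -
  have "policy_value_exists M ps s"
    using opt by (simp add: optimal_from_def)
  then have int: "integrable (measure_pmf (ps s)) (Qstar M ps s)"
    by (simp add: policy_value_exists_iff[OF M, of ps s])
  have "measure_pmf.expectation (ps s) (\<lambda>a. Vstar M ps s - Qstar M ps s a) = 0"
    using int policy_value_Bellman[OF M, of ps s] by (simp add: Vstar_def)
  then have "AE a in measure_pmf (ps s). Vstar M ps s - Qstar M ps s a = 0"
    using int Qstar_le_Vstar[OF M opt]
    by (subst (asm) integral_nonneg_eq_0_iff_AE) auto
  then show ?thesis
    using that set_pmf_not_empty[of "ps s"] by (fastforce simp: AE_measure_pmf_iff)
qed

lemma optimality_gap_le:
  assumes "optimality_gap M ps = ereal \<rho>" "Qstar M ps s a \<noteq> Vstar M ps s"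
  shows "\<rho> \<le> Vstar M ps s - Qstar M ps s a"
proof -
  have "optimality_gap M ps \<le> ereal (Vstar M ps s - Qstar M ps s a)"
    unfolding optimality_gap_def using assms(2) by (intro INF_lower2[of "(s, a)"]) auto
  with assms(1) show ?thesis by simp
qed

section \<open>Independent sequences and counting in multisets\<close>

definition eluder_independent ::
    "('s \<Rightarrow> 'a \<Rightarrow> real) set \<Rightarrow> real \<Rightarrow> ('s \<times> 'a) list \<Rightarrow> bool" where
  "eluder_independent F \<epsilon> xs \<longleftrightarrow> (\<forall>i<length xs. \<not> eluder_dependent F \<epsilon> (xs ! i) (take i xs))"

lemma eluder_independent_Nil [simp]: "eluder_independent F \<epsilon> []"
  by (simp add: eluder_independent_def)

lemma eluder_independent_snoc:
  "eluder_independent F \<epsilon> (xs @ [x]) \<longleftrightarrow>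
    eluder_independent F \<epsilon> xs \<and> \<not> eluder_dependent F \<epsilon> x xs"
  by (auto simp: eluder_independent_def nth_append less_Suc_eq)

text \<open>The supremum ranges over all larger scales too. This lets the dimension at
  \<open>\<rho> / 4\<close> bound sequences that are independent at the larger \<open>scale\<close>
  used below.\<close>

lemma length_le_eluder_dimension:
  assumes "eluder_dimension F \<epsilon> = enat d" "\<epsilon> \<le> \<epsilon>'" "eluder_independent F \<epsilon>' xs"
  shows "length xs \<le> d"
proof -
  have "enat (length xs) \<le> eluder_dimension F \<epsilon>"
    unfolding eluder_dimension_def using assms(2,3)
    by (intro SUP_upper) (auto simp: eluder_independent_def)
  with assms(1) show ?thesis by simp
qed

text \<open>Each element of \<open>P\<close> costs at most one list, one that contains it. The list
  is dropped whole, because the lower bound on the squared distance in \<open>covered_insert\<close>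
  holds for entire sequences only.\<close>

lemma sublists_avoiding:
  assumes "mset (concat bs) \<subseteq># A + P"
  shows "\<exists>bs'. set bs' \<subseteq> set bs \<and> length bs \<le> length bs' + size P \<and> mset (concat bs') \<subseteq># A"
  using assms
proof (induction P arbitrary: bs)
  case empty
  then show ?case by auto
next
  case (add x P)
  show ?case
  proof (cases "\<exists>b\<in>set bs. x \<in> set b")
    case True
    then obtain b l r where b: "x \<in> set b" "bs = l @ b # r"
      by (metis split_list)
    have "mset (concat (l @ r)) + {#x#} \<subseteq># mset (concat bs)"
      using b by (auto simp: subset_mset.add_mono mset_subset_eq_single ac_simps)
    also have "\<dots> \<subseteq># (A + P) + {#x#}" using add.prems by simp
    finally have "mset (concat (l @ r)) \<subseteq># A + P" by simp
    from add.IH[OF this] obtain bs' where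
      "set bs' \<subseteq> set (l @ r)" "length (l @ r) \<le> length bs' + size P" "mset (concat bs') \<subseteq># A"
      by blast
    with b show ?thesis by (intro exI[of _ bs']) auto
  next
    case False
    then have "x \<notin># mset (concat bs)" by auto
    with add.prems have "mset (concat bs) \<subseteq># A + P"
      by (metis add_mset_add_single union_mset_add_mset_right diff_single_trivial subset_eq_diff_conv)
    from add.IH[OF this] show ?thesis by (auto intro: le_trans)
  qed
qed

lemma sum_list_gt_length:
  fixes c :: real
  assumes "xs \<noteq> []" "\<And>x. x \<in> set xs \<Longrightarrow> c < g x"
  shows "real (length xs) * c < (\<Sum>x\<leftarrow>xs. g x)"
  using assms
proof (induction xs rule: list_nonempty_induct)
  case (cons x xs)
  then have "real (length xs) * c < (\<Sum>x\<leftarrow>xs. g x)" "c < g x" by auto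
  then show ?case by (simp add: algebra_simps)
qed auto

lemma sum_mset_mono_subset:
  fixes g :: "'b \<Rightarrow> real"
  assumes "A \<subseteq># B" "\<And>x. 0 \<le> g x"
  shows "(\<Sum>x\<in>#A. g x) \<le> (\<Sum>x\<in>#B. g x)"
proof -
  obtain C where "B = A + C" using assms(1) by (auto simp: mset_subset_eq_exists_conv)
  moreover have "0 \<le> (\<Sum>x\<in>#C. g x)" by (induction C) (simp_all add: assms(2))
  ultimately show ?thesis by simp
qed

section \<open>Sample bookkeeping and the guarantee of the oracle\<close>

definition queries :: "('s, 'a) dataset \<Rightarrow> ('s \<times> 'a) multiset" where
  "queries Y = image_mset (\<lambda>(s, a, y). (s, a)) Y"

lemma size_queries [simp]: "size (queries Y) = size Y"
  by (simp add: queries_def)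

lemma queries_record_sample [simp]:
  "queries (dataset (record_sample s a y m)) = add_mset (s, a) (queries (dataset m))"
  by (simp add: queries_def record_sample_def)

lemma size_record_sample [simp]: "size (dataset (record_sample s a y m)) = Suc (size (dataset m))"
  by (simp add: record_sample_def)

lemma memory_update_simps [simp]:
  "dataset (end_trajectory m) = dataset m"
  "policy (end_trajectory m) = policy m"
  "trajectories (end_trajectory m) = Suc (trajectories m)"
  "policy (record_sample s a y m) = policy m"
  "trajectories (record_sample s a y m) = trajectories m"
  "dataset (fit_and_act fit greedy s m) = dataset m"
  "trajectories (fit_and_act fit greedy s m) = trajectories m"
  "policy (fit_and_act fit greedy s m) = (policy m)(s := greedy (fit (dataset m)) s)"
  by (simp_all add: end_trajectory_def record_sample_def fit_and_act_def)

text \<open>The surplus of one in a call of Explore is the greedy run of step (5). Inside the loop,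
  the surplus of a recursive call is balanced by the sample recorded right after it.\<close>

lemma explore_trajectories:
  "explore M oracl fit greedy \<rho> \<delta> s m m' v \<Longrightarrow>
    trajectories m' + size (dataset m) = trajectories m + size (dataset m') + 1"
  "explore_loop M oracl fit greedy \<rho> \<delta> s m m' \<Longrightarrow>
    trajectories m' + size (dataset m) = trajectories m + size (dataset m')"
  by (induction rule: explore_explore_loop.inducts) simp_all

lemma explore_dataset_mono:
  "explore M oracl fit greedy \<rho> \<delta> s m m' v \<Longrightarrow> size (dataset m) \<le> size (dataset m')"
  "explore_loop M oracl fit greedy \<rho> \<delta> s m m' \<Longrightarrow> size (dataset m) \<le> size (dataset m')"
  by (induction rule: explore_explore_loop.inducts) simp_all

lemma admissible_pair_sum_le:
  assumes "admissible_pair F \<eta> Y f1 f2"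
  shows "(\<Sum>(s, a)\<in>#queries Y. \<bar>f1 s a - f2 s a\<bar>\<^sup>2) \<le> real (size Y) * \<eta>\<^sup>2"
proof -
  have eq: "(\<Sum>(s, a)\<in>#queries Y. \<bar>f1 s a - f2 s a\<bar>\<^sup>2) =
      (\<Sum>(s, a, y)\<in>#Y. \<bar>f1 s a - f2 s a\<bar>\<^sup>2)"
    by (auto simp: queries_def multiset.map_comp intro!: arg_cong[where f = sum_mset] image_mset_cong)
  show ?thesis
  proof (cases "Y = {#}")
    case False
    then have "0 < real (size Y)" by (simp add: nonempty_has_size)
    then show ?thesis
      using assms False unfolding eq admissible_pair_def by (simp add: field_simps)
  qed (simp add: queries_def)
qed

lemma oracle_witness:
  assumes "max_uncertainty_oracle F oracl" "0 \<le> \<eta>" "oracl s \<eta> Y = (a, u)"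
  obtains f1 f2 where "admissible_pair F \<eta> Y f1 f2" "u = \<bar>f1 s a - f2 s a\<bar>"
    "\<And>b g1 g2. admissible_pair F \<eta> Y g1 g2 \<Longrightarrow> \<bar>g1 s b - g2 s b\<bar> \<le> u"
proof -
  obtain f1 f2 where f: "admissible_pair F \<eta> Y f1 f2"
    "\<And>b g1 g2. admissible_pair F \<eta> Y g1 g2 \<Longrightarrow> \<bar>g1 s b - g2 s b\<bar>\<^sup>2 \<le> \<bar>f1 s a - f2 s a\<bar>\<^sup>2"
    "u = \<bar>f1 s a - f2 s a\<bar>"
    using assms(1)[unfolded max_uncertainty_oracle_def, rule_format, OF assms(2), of Y s] assms(3)
    by auto
  show ?thesis
  proof (rule that[OF f(1,3)])
    fix b g1 g2
    assume "admissible_pair F \<eta> Y g1 g2"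
    from f(2)[OF this] show "\<bar>g1 s b - g2 s b\<bar> \<le> u"
      unfolding f(3) by (simp add: abs_le_square_iff)
  qed
qed

section \<open>Packing bound and termination\<close>

locale exploration =
  fixes M :: "('s, 'a) system"
    and F :: "('s \<Rightarrow> 'a \<Rightarrow> real) set"
    and oracl :: "'s \<Rightarrow> real \<Rightarrow> ('s, 'a) dataset \<Rightarrow> 'a \<times> real"
    and fit :: "('s, 'a) dataset \<Rightarrow> 's \<Rightarrow> 'a \<Rightarrow> real"
    and greedy :: "('s \<Rightarrow> 'a \<Rightarrow> real) \<Rightarrow> 's \<Rightarrow> 'a"
    and \<rho> \<delta> :: real and d :: nat
  assumes system: "episodic_system M"
    and dim: "eluder_dimension F (\<rho> / 4) = enat d" and d_pos: "1 \<le> d"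
    and \<delta>_nonneg: "0 \<le> \<delta>"
    and gap_large: "6 * sqrt 2 * \<delta> * sqrt (real d) \<le> \<rho>"
    and oracl: "max_uncertainty_oracle F oracl"
begin

abbreviation "Explore \<equiv> explore M oracl fit greedy \<rho> \<delta>"
abbreviation "Loop \<equiv> explore_loop M oracl fit greedy \<rho> \<delta>"

text \<open>With this scale, a set of \<open>2 * horizon M * d\<close> data points on which two admissible functions
  are compared cannot contain \<open>horizon M + 1\<close> disjoint parts on each of which they are
  \<open>scale\<close>-far apart; \<open>\<rho> / 4\<close> itself is too small for this count.\<close>
definition scale :: real where "scale = sqrt 2 * \<rho> / 4"

lemma \<rho>_nonneg: "0 \<le> \<rho>"
  using gap_large \<delta>_nonneg by (smt (verit) mult_nonneg_nonneg real_sqrt_ge_zero of_nat_0_le_iff)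

text \<open>Squaring \<open>gap_large\<close> gives the constant 72, and the square of
  \<open>scale\<close> is the square of \<rho> divided by 8.\<close>

lemma scale_sq: "9 * \<delta>\<^sup>2 * real d \<le> scale\<^sup>2"
proof -
  have "(6 * sqrt 2 * \<delta> * sqrt (real d))\<^sup>2 \<le> \<rho>\<^sup>2"
    using gap_large \<delta>_nonneg by (intro power_mono) auto
  then show ?thesis by (simp add: scale_def power_mult_distrib power_divide)
qed

lemma sqrt2_bounds: "7 / 5 \<le> sqrt 2" "sqrt 2 \<le> 3 / 2"
  by (rule real_le_rsqrt, simp add: power2_eq_square, rule real_le_lsqrt)
    (simp_all add: power2_eq_square)

lemma scale_ge: "\<rho> / 4 \<le> scale" and scale_nonneg: "0 \<le> scale"
  using mult_right_mono[OF sqrt2_bounds(1) \<rho>_nonneg] \<rho>_nonneg by (auto simp: scale_def)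

text \<open>Obtained from \<open>d_pos\<close> and \<open>7 / 5 \<le> sqrt 2\<close>. It is just
  fine enough for \<open>scale_le_threshold\<close>, where \<open>sqrt 2 \<le> 3 / 2\<close> reduces
  the claim to 3/8 + 5/42 \<le> 1/2.\<close>

lemma error_le: "42 * \<delta> \<le> 5 * \<rho>"
proof -
  have "7 / 5 * \<delta> \<le> sqrt 2 * \<delta>"
    using sqrt2_bounds \<delta>_nonneg by (intro mult_right_mono) auto
  moreover have "sqrt 2 * \<delta> * 1 \<le> sqrt 2 * \<delta> * sqrt (real d)"
    using d_pos \<delta>_nonneg by (intro mult_left_mono) auto
  ultimately show ?thesis using gap_large by linarith
qed

lemma threshold_eq: "\<bar>\<rho> / 2 - \<delta>\<bar> = \<rho> / 2 - \<delta>"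
  using error_le \<delta>_nonneg by linarith

lemma scale_le_threshold: "scale \<le> \<rho> / 2 - \<delta>"
  using mult_right_mono[OF sqrt2_bounds(2) \<rho>_nonneg] error_le \<rho>_nonneg by (simp add: scale_def)

text \<open>\<open>P\<close> holds the actions that the pending calls of Explore have chosen but not yet recorded.
  They are counted as if they were in the data set already: in the order of recording, an action
  need not be independent of the samples that were collected while it was pending.\<close>
definition covered :: "('s, 'a) dataset \<Rightarrow> ('s \<times> 'a) multiset \<Rightarrow> bool" where
  "covered Y P \<longleftrightarrow> (\<exists>bs. length bs = 2 * horizon M \<and>
     (\<forall>b\<in>set bs. eluder_independent F scale b) \<and> mset (concat bs) = queries Y + P)"

lemma length_concat_le:
  assumes "\<forall>b\<in>set bs. eluder_independent F scale b"
  shows "length (concat bs) \<le> length bs * d"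
  using assms
proof (induction bs)
  case (Cons b bs)
  then have "length b \<le> d"
    using length_le_eluder_dimension[OF dim scale_ge] by auto
  with Cons show ?case by auto
qed simp

lemma covered_size:
  assumes "covered Y P"
  shows "size Y + size P \<le> 2 * horizon M * d"
proof -
  obtain bs where bs: "length bs = 2 * horizon M" "\<forall>b\<in>set bs. eluder_independent F scale b"
    "mset (concat bs) = queries Y + P"
    using assms by (auto simp: covered_def)
  from arg_cong[OF bs(3), of size] length_concat_le[OF bs(2)] bs(1) show ?thesis by simp
qed

lemma covered_insert:
  assumes cov: "covered Y P" and P: "size P < horizon M"
    and query: "oracl s (2 * \<delta>) Y = (a, u)" "\<bar>\<rho> / 2 - \<delta>\<bar> < u"
  shows "covered Y (add_mset (s, a) P)"
proof -
  obtain bs where bs: "length bs = 2 * horizon M" "\<forall>b\<in>set bs. eluder_independent F scale b"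
    "mset (concat bs) = queries Y + P"
    using cov by (auto simp: covered_def)
  obtain f1 f2 where f: "admissible_pair F (2 * \<delta>) Y f1 f2" "u = \<bar>f1 s a - f2 s a\<bar>"
    using oracle_witness[OF oracl _ query(1)] \<delta>_nonneg by (metis mult_nonneg_nonneg zero_le_numeral)
  define g where "g = (\<lambda>(s, a). \<bar>f1 s a - f2 s a\<bar>\<^sup>2)"
  have "scale < u" using query(2) scale_le_threshold threshold_eq by linarith
  then have far: "scale\<^sup>2 < \<bar>f1 s a - f2 s a\<bar>\<^sup>2"
    unfolding f(2) using scale_nonneg by (intro power_strict_mono) auto
  have "\<exists>b\<in>set bs. \<not> eluder_dependent F scale (s, a) b"
  proof (rule ccontr)
    assume "\<not> (\<exists>b\<in>set bs. \<not> eluder_dependent F scale (s, a) b)"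
    \<comment> \<open>Contrapositive of dependence: \<open>f1\<close> and \<open>f2\<close> differ
      by more than \<open>scale\<close> at \<open>(s, a)\<close>, so they cannot be close on
      \<open>b\<close>.\<close>
    have big: "scale\<^sup>2 < (\<Sum>x\<leftarrow>b. g x)" if "b \<in> set bs" for b
    proof (rule ccontr)
      assume "\<not> scale\<^sup>2 < (\<Sum>x\<leftarrow>b. g x)"
      moreover have "eluder_dependent F scale (s, a) b" "f1 \<in> F" "f2 \<in> F"
        using that f(1) \<open>\<not> (\<exists>b\<in>set bs. \<not> eluder_dependent F scale (s, a) b)\<close>
        by (auto simp: admissible_pair_def)
      ultimately have "\<bar>f1 s a - f2 s a\<bar>\<^sup>2 \<le> scale\<^sup>2"
        unfolding eluder_dependent_def g_def not_less fst_conv snd_conv by blast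
      with far show False by simp
    qed
    obtain bs' where bs': "set bs' \<subseteq> set bs" "length bs \<le> length bs' + size P"
      "mset (concat bs') \<subseteq># queries Y"
      using sublists_avoiding[of bs "queries Y" P] bs(3) by auto
    \<comment> \<open>At most \<open>horizon M - 1\<close> of the \<open>2 * horizon M\<close>
      sequences are lost to pending actions.\<close>
    have len: "horizon M + 1 \<le> length bs'" using bs'(2) bs(1) P by linarith
    have "real (horizon M + 1) * scale\<^sup>2 \<le> real (length bs') * scale\<^sup>2"
      using len by (intro mult_right_mono) auto
    also have "\<dots> < (\<Sum>b\<leftarrow>bs'. \<Sum>x\<leftarrow>b. g x)"
      using len bs'(1) big by (intro sum_list_gt_length) auto
    also have "\<dots> = (\<Sum>x\<in>#mset (concat bs'). g x)"
      by (induction bs') (simp_all add: sum_mset_sum_list flip: mset_map)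
    also have "\<dots> \<le> (\<Sum>x\<in>#queries Y. g x)"
      using bs'(3) by (rule sum_mset_mono_subset) (auto simp: g_def)
    also have "\<dots> \<le> real (size Y) * (2 * \<delta>)\<^sup>2"
      using admissible_pair_sum_le[OF f(1)] by (simp add: g_def)
    also have "\<dots> \<le> real (2 * horizon M * d) * (2 * \<delta>)\<^sup>2"
      using covered_size[OF cov] by (intro mult_right_mono) (simp_all flip: of_nat_mult)
    \<comment> \<open>The factor 8 is 2 from the number of sequences times 4 from the radius
      \<open>2 * \<delta>\<close>; it stays below the 9 of \<open>scale_sq\<close>.\<close>
    also have "\<dots> = real (horizon M) * (8 * (\<delta>\<^sup>2 * real d))"
      by (simp add: power_mult_distrib)
    also have "\<dots> \<le> real (horizon M + 1) * scale\<^sup>2"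
    proof (intro mult_mono)
      show "8 * (\<delta>\<^sup>2 * real d) \<le> scale\<^sup>2"
        using scale_sq mult_nonneg_nonneg[OF zero_le_power2[of \<delta>] of_nat_0_le_iff[of d]] by linarith
    qed auto
    finally show False by simp
  qed
  then obtain b l r where b: "\<not> eluder_dependent F scale (s, a) b" "bs = l @ b # r"
    by (metis split_list)
  with bs show ?thesis
    unfolding covered_def
    by (intro exI[of _ "l @ (b @ [(s, a)]) # r"]) (auto simp: eluder_independent_snoc)
qed

lemma covered_record_sample:
  "covered (dataset (record_sample s a y m)) P \<longleftrightarrow> covered (dataset m) (add_mset (s, a) P)"
  by (simp add: covered_def)

text \<open>\<open>size P < level M s\<close> reflects that each earlier level holds at most one
  pending action. A recursive call of the loop adds one and goes one level deeper; recording moves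
  the action from \<open>P\<close> to the data set. The greedy action of step (5) is never recorded,
  so \<open>P\<close> is unchanged there.\<close>

lemma explore_covered:
  "Explore s m m' v \<Longrightarrow> covered (dataset m) P \<Longrightarrow> size P < level M s \<Longrightarrow> covered (dataset m') P"
  "Loop s m m' \<Longrightarrow> covered (dataset m) P \<Longrightarrow> size P < level M s \<Longrightarrow> covered (dataset m') P"
proof (induction arbitrary: P and P rule: explore_explore_loop.inducts)
  case (loop_last s m a u m')
  have "size P < horizon M" using loop_last.prems level_bounds(2)[OF system, of s] by simp
  with loop_last covered_insert show ?case by (simp add: covered_record_sample)
next
  case (loop_rec s m a u m1 v m')
  have "size P < horizon M" using loop_rec.prems level_bounds(2)[OF system, of s] by simp
  then have "covered (dataset m) (add_mset (s, a) P)"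
    using loop_rec covered_insert by blast
  moreover have "size (add_mset (s, a) P) < level M (trans M s a)"
    using loop_rec level_trans[OF system level_less_horizon[OF system]] by simp
  ultimately have "covered (dataset m1) (add_mset (s, a) P)" using loop_rec by blast
  with loop_rec show ?case by (simp add: covered_record_sample)
next
  case (explore_rec s m m1 m2 m3 v)
  then show ?case
    using level_trans[OF system level_less_horizon[OF system]] by simp
qed auto

text \<open>The measure is the room left below the bound of \<open>covered_size\<close>; every
  iteration records a sample and lowers it. \<open>rec\<close> is the termination of calls one level
  deeper.\<close>

lemma loop_terminates:
  assumes rec: "\<And>a m P. \<lbrakk>s \<notin> stage M (horizon M); covered (dataset m) P;
      size P < level M (trans M s a)\<rbrakk> \<Longrightarrow> \<exists>m' v. Explore (trans M s a) m m' v"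
    and "covered (dataset m) P" "size P < level M s"
  shows "\<exists>m'. Loop s m m'"
  using assms(2,3)
proof (induction "2 * horizon M * d - size (dataset m)" arbitrary: m rule: less_induct)
  case less
  obtain a u where q: "oracl s (2 * \<delta>) (dataset m) = (a, u)" by fastforce
  show ?case
  proof (cases "\<bar>\<rho> / 2 - \<delta>\<bar> < u")
    case True
    have "size P < horizon M" using less.prems level_bounds(2)[OF system, of s] by simp
    then have cov: "covered (dataset m) (add_mset (s, a) P)"
      using covered_insert less.prems q True by blast
    \<comment> \<open>The action just chosen is already counted as pending, which makes the
      inequality strict.\<close>
    then have room: "size (dataset m) < 2 * horizon M * d" using covered_size by fastforce
    show ?thesis
    proof (cases "s \<in> stage M (horizon M)")
      case last: True
      have "\<exists>m'. Loop s (record_sample s a (reward M s a) (end_trajectory m)) m'"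
        using room cov less.prems by (intro less.hyps) (auto simp: covered_record_sample)
      with q True last show ?thesis by (blast intro: loop_last)
    next
      case False
      have P: "size (add_mset (s, a) P) < level M (trans M s a)"
        using less.prems level_trans[OF system level_less_horizon[OF system False]] by simp
      obtain m1 v where m1: "Explore (trans M s a) m m1 v" using rec[OF False cov P] by blast
      have "covered (dataset m1) (add_mset (s, a) P)" using explore_covered(1)[OF m1 cov P] .
      moreover have "size (dataset m) \<le> size (dataset m1)" using explore_dataset_mono(1)[OF m1] .
      ultimately have "\<exists>m'. Loop s (record_sample s a (v + reward M s a) m1) m'"
        using room less.prems by (intro less.hyps) (auto simp: covered_record_sample)
      with q True False m1 show ?thesis by (blast intro: loop_rec)
    qed
  qed (use q in \<open>blast intro: loop_exit\<close>)
qed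

lemma explore_terminates:
  "covered (dataset m) P \<Longrightarrow> size P < level M s \<Longrightarrow> \<exists>m' v. Explore s m m' v"
proof (induction "steps_left M s" arbitrary: s m P)
  \<comment> \<open>Vacuous: even in the last level one step is left.\<close>
  case 0
  then show ?case using level_bounds(2)[OF system, of s] by (simp add: steps_left_def)
next
  case (Suc n)
  have rec: "\<exists>m' v. Explore (trans M s a) m m' v"
    if "s \<notin> stage M (horizon M)" "covered (dataset m) P" "size P < level M (trans M s a)" for a m P
    using that Suc.hyps(1)[OF _ that(2,3)] Suc.hyps(2) steps_left_trans[OF system that(1)]
    by (metis Suc_inject)
  have "\<exists>m1. Loop s m m1" by (rule loop_terminates[OF _ Suc.prems]) (rule rec)
  then obtain m1 where m1: "Loop s m m1" by blast
  show ?case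
  proof (cases "s \<in> stage M (horizon M)")
    case True
    with m1 show ?thesis by (blast intro: explore_last)
  next
    case False
    define m2 where "m2 = fit_and_act fit greedy s m1"
    have "covered (dataset m2) P"
      using explore_covered(2)[OF m1] Suc.prems by (simp add: m2_def)
    then obtain m3 v where "Explore (trans M s (policy m2 s)) m2 m3 v"
      using rec[OF False] Suc.prems level_trans[OF system level_less_horizon[OF system False]]
      by fastforce
    with m1 False show ?thesis unfolding m2_def by (blast intro: explore_rec)
  qed
qed

lemma covered_empty: "covered {#} {#}"
  unfolding covered_def queries_def
  by (intro exI[of _ "replicate (2 * horizon M) []"]) auto

end

section \<open>Correctness of the greedy actions\<close>

lemma least_squares_admissible:
  assumes fit: "least_squares F fit" and g: "g \<in> F" "\<And>s a. \<bar>g s a - q s a\<bar> \<le> \<delta>"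
    and exact: "\<forall>(s, a, y)\<in>#Y. y = q s a"
  shows "admissible_pair F (2 * \<delta>) Y (fit Y) g"
proof -
  define f where "f = fit Y"
  have f: "f \<in> F" "squared_loss Y f \<le> squared_loss Y g"
    using fit g(1) by (auto simp: least_squares_def f_def)
  \<comment> \<open>Comparing \<open>f\<close> and \<open>g\<close> through the recorded value
    \<open>y\<close> costs a factor 2 on each loss. Both losses are at most
    \<open>size Y * \<delta>\<^sup>2\<close>, which yields exactly the radius
    \<open>2 * \<delta>\<close>.\<close>
  have sq: "(x - z)\<^sup>2 \<le> 2 * (x - y)\<^sup>2 + 2 * (z - y)\<^sup>2" for x y z :: real
    using zero_le_power2[of "x + z - 2 * y"] by (simp add: power2_eq_square algebra_simps)
  have "(\<Sum>(s, a, y)\<in>#Y. \<bar>f s a - g s a\<bar>\<^sup>2) \<le>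
      (\<Sum>t\<in>#Y. 2 * (case t of (s, a, y) \<Rightarrow> \<bar>f s a - y\<bar>\<^sup>2) + 2 * (case t of (s, a, y) \<Rightarrow> \<bar>g s a - y\<bar>\<^sup>2))"
    by (intro sum_mset_mono) (auto intro: sq)
  also have "\<dots> = 2 * squared_loss Y f + 2 * squared_loss Y g"
    by (simp add: squared_loss_def sum_mset.distrib sum_mset_distrib_left)
  also have "\<dots> \<le> 4 * squared_loss Y g" using f(2) by simp
  also have "squared_loss Y g \<le> (\<Sum>t\<in>#Y. \<delta>\<^sup>2)"
    unfolding squared_loss_def
  proof (intro sum_mset_mono)
    fix t
    assume "t \<in># Y"
    moreover obtain s a y where t: "t = (s, a, y)" by (cases t)
    ultimately have "y = q s a" using exact by auto
    then show "(case t of (s, a, y) \<Rightarrow> \<bar>g s a - y\<bar>\<^sup>2) \<le> \<delta>\<^sup>2"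
      using power_mono[OF g(2)[of s a], of 2] unfolding t by simp
  qed
  finally have le: "(\<Sum>(s, a, y)\<in>#Y. \<bar>f s a - g s a\<bar>\<^sup>2) \<le> real (size Y) * (2 * \<delta>)\<^sup>2"
    by (simp add: power_mult_distrib)
  have "1 / real (size Y) * (\<Sum>(s, a, y)\<in>#Y. \<bar>f s a - g s a\<bar>\<^sup>2) \<le> (2 * \<delta>)\<^sup>2" if "Y \<noteq> {#}"
  proof -
    have "0 < real (size Y)" using that by (simp add: nonempty_has_size)
    with le show ?thesis by (simp add: field_simps)
  qed
  with f(1) g(1) show ?thesis by (auto simp: admissible_pair_def f_def)
qed

locale optimal_exploration = exploration M F oracl fit greedy \<rho> \<delta> d
  for M :: "('s, 'a) system" and F oracl fit greedy \<rho> \<delta> d +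
  fixes ps :: "'s \<Rightarrow> 'a pmf"
  assumes ps_optimal: "\<And>s. optimal_from M s ps"
    and gap: "optimality_gap M ps = ereal \<rho>"
    and err_attained: "\<exists>f\<in>F. \<forall>s a. \<bar>f s a - Qstar M ps s a\<bar> \<le> \<delta>"
    and fit: "least_squares F fit"
    and greedy: "greedy_selector F greedy"
    and no_bad_tie: "\<And>s Y a b.
      \<lbrakk>\<forall>(s', a', y')\<in>#Y. y' = Qstar M ps s' a';
       snd (oracl s (2 * \<delta>) Y) = \<bar>\<rho> / 2 - \<delta>\<bar>;
       maximizes (fit Y) s a; maximizes (fit Y) s b;
       Qstar M ps s a = Vstar M ps s\<rbrakk>
      \<Longrightarrow> Qstar M ps s b = Vstar M ps s"
begin

definition exact :: "('s, 'a) dataset \<Rightarrow> bool" where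
  "exact Y \<longleftrightarrow> (\<forall>(s, a, y)\<in>#Y. y = Qstar M ps s a)"

lemma greedy_optimal:
  assumes exact: "exact Y" and u: "snd (oracl s (2 * \<delta>) Y) \<le> \<bar>\<rho> / 2 - \<delta>\<bar>"
  shows "Qstar M ps s (greedy (fit Y) s) = Vstar M ps s"
proof (rule ccontr)
  define f where "f = fit Y"
  define b where "b = greedy f s"
  assume "Qstar M ps s (greedy (fit Y) s) \<noteq> Vstar M ps s"
  then have bad: "Qstar M ps s b \<noteq> Vstar M ps s" by (simp add: b_def f_def)
  have "f \<in> F" using fit by (simp add: f_def least_squares_def)
  then have max: "maximizes f s b" using greedy by (simp add: b_def greedy_selector_def)
  obtain g where g: "g \<in> F" "\<And>s a. \<bar>g s a - Qstar M ps s a\<bar> \<le> \<delta>" using err_attained by blast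
  obtain c u where cu: "oracl s (2 * \<delta>) Y = (c, u)" by fastforce
  have adm: "admissible_pair F (2 * \<delta>) Y f g"
    using least_squares_admissible[OF fit g] exact by (simp add: exact_def f_def)
  have near: "\<bar>f s a - g s a\<bar> \<le> u" for a
    using oracle_witness[OF oracl _ cu] adm \<delta>_nonneg
    by (metis mult_nonneg_nonneg zero_le_numeral)
  obtain a where a: "Qstar M ps s a = Vstar M ps s"
    using optimal_action_exists[OF system ps_optimal] by blast
  have le_u: "u \<le> \<rho> / 2 - \<delta>" using u cu threshold_eq by simp
  have "f s a \<le> f s b" using max by (simp add: maximizes_def)
  moreover have "\<rho> \<le> Vstar M ps s - Qstar M ps s b" using optimality_gap_le[OF gap bad] .
  \<comment> \<open>The four closeness bounds and \<open>f s a \<le> f s b\<close> limit the loss of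
    \<open>b\<close> to \<open>2 * (u + \<delta>)\<close>, which is at most \<rho>. The gap makes
    the loss at least \<rho>, so every inequality in the chain is an equality.\<close>
  ultimately have eq: "u = \<rho> / 2 - \<delta>" "f s a = f s b"
    using le_u near[of a] near[of b] g(2)[of s a] g(2)[of s b] a by linarith+
  have "maximizes f s a" using max eq(2) by (simp add: maximizes_def)
  then have "Qstar M ps s b = Vstar M ps s"
    using no_bad_tie[of Y s a b] exact cu eq(1) threshold_eq a max
    by (simp add: exact_def f_def)
  with bad show False by simp
qed

text \<open>The clauses on unchanged policies are what the induction needs: calls in deeper levels
  do not overwrite the action fixed at \<open>s\<close>. The call of step (5) runs last, so its
  optimality claim concerns the final policy.\<close>

lemma explore_correct:
  "Explore s m m' v \<Longrightarrow> exact (dataset m) \<Longrightarrow>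
    exact (dataset m') \<and> v = Vstar M ps s \<and>
    policy_value M (\<lambda>t. return_pmf (policy m' t)) s = Vstar M ps s \<and>
    (\<forall>t. level M t < level M s \<longrightarrow> policy m' t = policy m t)"
  "Loop s m m' \<Longrightarrow> exact (dataset m) \<Longrightarrow>
    exact (dataset m') \<and> snd (oracl s (2 * \<delta>) (dataset m')) \<le> \<bar>\<rho> / 2 - \<delta>\<bar> \<and>
    (\<forall>t. level M t \<le> level M s \<longrightarrow> policy m' t = policy m t)"
proof (induction rule: explore_explore_loop.inducts)
  case (loop_exit s m a u)
  then show ?case by simp
next
  case (loop_last s m a u m')
  then have "Qstar M ps s a = reward M s a" by (simp add: Qstar_def)
  with loop_last show ?case by (simp add: exact_def record_sample_def)
next
  case (loop_rec s m a u m1 v m')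
  then have "Qstar M ps s a = v + reward M s a" by (simp add: Qstar_def Vstar_def)
  with loop_rec have "exact (dataset (record_sample s a (v + reward M s a) m1))"
    by (simp add: exact_def record_sample_def)
  with loop_rec show ?case
    using level_trans[OF system level_less_horizon[OF system]] by simp
next
  case (explore_last s m m1 m2)
  then have "Qstar M ps s (policy m2 s) = Vstar M ps s"
    using greedy_optimal by simp
  with explore_last show ?case
    by (auto simp: policy_value_return_pmf[OF system] Qstar_def)
next
  case (explore_rec s m m1 m2 m3 v)
  define b where "b = policy m2 s"
  have not_last: "s \<notin> stage M (horizon M)" and m2: "m2 = fit_and_act fit greedy s m1"
    using explore_rec by blast+
  have loop: "exact (dataset m1)" "snd (oracl s (2 * \<delta>) (dataset m1)) \<le> \<bar>\<rho> / 2 - \<delta>\<bar>"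
    "\<And>t. level M t \<le> level M s \<Longrightarrow> policy m1 t = policy m t"
    using explore_rec by blast+
  have lev: "level M (trans M s b) = Suc (level M s)"
    using level_trans[OF system level_less_horizon[OF system not_last]] .
  have opt: "Qstar M ps s b = Vstar M ps s"
    using greedy_optimal[OF loop(1,2)] by (simp add: b_def m2)
  have "exact (dataset m2)" using loop(1) by (simp add: m2)
  then have IH: "exact (dataset m3)" "v = Vstar M ps (trans M s b)"
    "policy_value M (\<lambda>t. return_pmf (policy m3 t)) (trans M s b) = Vstar M ps (trans M s b)"
    "\<And>t. level M t \<le> level M s \<Longrightarrow> policy m3 t = policy m2 t"
    using explore_rec.IH(6) lev unfolding b_def by auto
  \<comment> \<open>The successor lies one level deeper, so \<open>IH(4)\<close> covers
    \<open>s\<close> itself.\<close>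
  have "policy m3 s = b" using IH(4) by (simp add: b_def)
  then have "policy_value M (\<lambda>t. return_pmf (policy m3 t)) s = Vstar M ps s"
    using IH(3) opt not_last
    by (simp add: policy_value_return_pmf[OF system, of _ s] Qstar_def Vstar_def)
  moreover have "reward M s b + v = Vstar M ps s"
    using IH(2) opt not_last by (simp add: Qstar_def Vstar_def)
  moreover have "policy m3 t = policy m t" if "level M t < level M s" for t
    using IH(4)[of t] loop(3)[of t] that by (auto simp: m2)
  ultimately show ?case using IH(1) by (simp add: b_def)
qed

end

text \<open>The factor \<open>horizon M\<close> in the bound comes from the pending actions, which
  may block up to \<open>horizon M - 1\<close> sequences. \<open>err_attained\<close> provides an
  actual best approximation of \<open>Qstar\<close>; \<open>no_bad_tie\<close> settles a loop exit
  with uncertainty equal to the threshold.\<close>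

theorem theorem5p1:
  fixes M :: "('s, 'a) system"
    and F :: "('s \<Rightarrow> 'a \<Rightarrow> real) set"
    and ps :: "'s \<Rightarrow> 'a pmf"
    and oracl :: "'s \<Rightarrow> real \<Rightarrow> ('s, 'a) dataset \<Rightarrow> 'a \<times> real"
    and fit :: "('s, 'a) dataset \<Rightarrow> 's \<Rightarrow> 'a \<Rightarrow> real"
    and greedy :: "('s \<Rightarrow> 'a \<Rightarrow> real) \<Rightarrow> 's \<Rightarrow> 'a"
    and \<rho> \<delta> :: real and d :: nat
    and f0 :: "'s \<Rightarrow> 'a \<Rightarrow> real" and p0 :: "'s \<Rightarrow> 'a"
  assumes system: "episodic_system M"
    and ps_optimal: "\<And>s. optimal_from M s ps"
    and gap: "optimality_gap M ps = ereal \<rho>"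
    and err: "approximation_error M ps F = ereal \<delta>"
    and err_attained: "\<exists>f\<in>F. \<forall>s a. \<bar>f s a - Qstar M ps s a\<bar> \<le> \<delta>"
    and dim: "eluder_dimension F (\<rho> / 4) = enat d" "1 \<le> d"
    and gap_large: "\<rho> \<ge> 6 * sqrt 2 * \<delta> * sqrt (real d)"
    and oracl: "max_uncertainty_oracle F oracl"
    and fit: "least_squares F fit"
    and greedy: "greedy_selector F greedy"
    and no_bad_tie: "\<And>s Y a b.
      \<lbrakk>\<forall>(s', a', y')\<in>#Y. y' = Qstar M ps s' a';
       snd (oracl s (2 * \<delta>) Y) = \<bar>\<rho> / 2 - \<delta>\<bar>;
       maximizes (fit Y) s a; maximizes (fit Y) s b;
       Qstar M ps s a = Vstar M ps s\<rbrakk>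
      \<Longrightarrow> Qstar M ps s b = Vstar M ps s"
  shows "(\<exists>m. main_algorithm M oracl fit greedy \<rho> \<delta> f0 p0 m) \<and>
    (\<forall>m. main_algorithm M oracl fit greedy \<rho> \<delta> f0 p0 m \<longrightarrow>
       optimal_from M (start M) (\<lambda>s. return_pmf (policy m s)) \<and>
       real (trajectories m) \<le> 4 * real (horizon M) * real d)"
proof -
  obtain f where "\<forall>s a. \<bar>f s a - Qstar M ps s a\<bar> \<le> \<delta>" using err_attained by blast
  then have "0 \<le> \<delta>" by (meson abs_ge_zero order_trans)
  then interpret optimal_exploration M F oracl fit greedy \<rho> \<delta> d ps
    using assms by unfold_locales (blast | simp)+
  let ?m = "\<lparr>dataset = {#}, estimate = f0, policy = p0, trajectories = 0\<rparr>"
  have "level M (start M) = 1"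
    using system by (intro level_eqI) (auto simp: episodic_system_def)
  then have start: "size {#} < level M (start M)" by simp
  have cov: "covered (dataset ?m) {#}" using covered_empty by simp
  have "\<exists>m. main_algorithm M oracl fit greedy \<rho> \<delta> f0 p0 m"
    using explore_terminates[OF cov start] by (auto simp: main_algorithm_def)
  moreover have "optimal_from M (start M) (\<lambda>s. return_pmf (policy m s)) \<and>
      real (trajectories m) \<le> 4 * real (horizon M) * real d"
    if main: "main_algorithm M oracl fit greedy \<rho> \<delta> f0 p0 m" for m
  proof
    obtain v where run: "Explore (start M) ?m m v" using main by (auto simp: main_algorithm_def)
    have "policy_value M (\<lambda>t. return_pmf (policy m t)) (start M) = policy_value M ps (start M)"
      using explore_correct(1)[OF run] by (simp add: exact_def Vstar_def)
    then show "optimal_from M (start M) (\<lambda>s. return_pmf (policy m s))"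
      using ps_optimal[of "start M"]
      by (simp add: optimal_from_def policy_value_exists_return_pmf)
    have "size (dataset m) \<le> 2 * horizon M * d"
      using covered_size[OF explore_covered(1)[OF run cov start]] by simp
    moreover have "trajectories m = size (dataset m) + 1"
      using explore_trajectories(1)[OF run] by simp
    \<comment> \<open>This absorbs the one trajectory that pays for no sample into the constant
      4.\<close>
    moreover have "1 \<le> horizon M * d"
      using system d_pos by (simp add: episodic_system_def)
    ultimately have "trajectories m \<le> 4 * horizon M * d" by linarith
    then have "real (trajectories m) \<le> real (4 * horizon M * d)" by (rule of_nat_mono)
    then show "real (trajectories m) \<le> 4 * real (horizon M) * real d" by simp
  qed
  ultimately show ?thesis by blast
qed

end
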